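(* Let $K$ be a finite group such that $3\nmid |K|$, and set $G=S_3\times K$. Let $s'=((12),1_K)$ and $t'=((23),1_K)$. Let $A$ be the multiset in $G$ consisting of $2|K|$ copies of $s'$ and $4|K|$ copies of $t'$. Then $A$ satisfies the abelianization obstruction and its elements admit an ordering whose product is $1$ in $G$, but $A$ is not quotient-realizable in $G$.
   Context: All multisets are counted with multiplicity; groups are written multiplicatively. Quotient-realizable: a multiset $A$ of cardinality $|G|$ with elements in a finite group $G$ is quotient-realizable in $G$ if there exist bijections $b,c:\{1,\ldots,|G|\}\to G$ such that $A=\{b(i)c(i)^{-1}:1\le i\le |G|\}$ as multisets. Abelianization obstruction: let $\pi:G\to G_{\mathrm{ab}}=G/[G,G]$ be the canonical projection. A multiset $A$ in $G$ satisfies the abelianization obstruction if $\prod_{a\in A}\pi(a)=1$ in $G_{\mathrm{ab}}$, the product being taken with multiplicity (it is independent of order since $G_{\mathrm{ab}}$ is abelian). Here $S_3$ is the symmetric group on $\{1,2,3\}$, with permutations composed from right to left. *)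

theory Defs
  imports "HOL-Algebra.Sym_Groups" "HOL-Algebra.FiniteProduct" "HOL-Library.Multiset"
begin

text \<open>
  For a finite group \<open>G\<close> the last conjunct forces \<open>A\<close> to have cardinality \<open>order G\<close> and all its
  elements to lie in \<open>carrier G\<close>, so these are not required separately.
\<close>

definition quotient_realizable :: "('a, 'm) monoid_scheme \<Rightarrow> 'a multiset \<Rightarrow> bool" where
  "quotient_realizable G A \<longleftrightarrow>
     (\<exists>b c. bij_betw b {1..order G} (carrier G) \<and>
            bij_betw c {1..order G} (carrier G) \<and>
            A = image_mset (\<lambda>i. b i \<otimes>\<^bsub>G\<^esub> inv\<^bsub>G\<^esub> (c i)) (mset_set {1..order G}))"

definition abelianization :: "('a, 'm) monoid_scheme \<Rightarrow> 'a set monoid" where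
  "abelianization G = G Mod (derived G (carrier G))"

definition abelianization_proj :: "('a, 'm) monoid_scheme \<Rightarrow> 'a \<Rightarrow> 'a set" where
  "abelianization_proj G a = derived G (carrier G) #>\<^bsub>G\<^esub> a"

text \<open>
  The product over the multiset \<open>A\<close> is taken over its distinct elements, each raised to its
  multiplicity in \<open>A\<close>.
\<close>

definition abelianization_obstruction :: "('a, 'm) monoid_scheme \<Rightarrow> 'a multiset \<Rightarrow> bool" where
  "abelianization_obstruction G A \<longleftrightarrow>
     set_mset A \<subseteq> carrier G \<and>
     (\<Otimes>\<^bsub>abelianization G\<^esub>a\<in>set_mset A.
        abelianization_proj G a [^]\<^bsub>abelianization G\<^esub> count A a) = \<one>\<^bsub>abelianization G\<^esub>"

definition has_ordering_with_product_one :: "('a, 'm) monoid_scheme \<Rightarrow> 'a multiset \<Rightarrow> bool" where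
  "has_ordering_with_product_one G A \<longleftrightarrow>
     (\<exists>xs. mset xs = A \<and> foldr (\<otimes>\<^bsub>G\<^esub>) xs \<one>\<^bsub>G\<^esub> = \<one>\<^bsub>G\<^esub>)"

end

(* Suppose A = {b(i) c(i)^-1} takes only the values s and t, and let S be the set of those c(i)
   with b(i) = s c(i).  If c(i) is in S and c(j) = t^-1 s c(i), then b(j) = t c(j) would give
   b(j) = b(i), hence c(j) = c(i) and s = t; so c(j) is in S.  Thus S is a union of right cosets
   of the subgroup generated by t^-1 s, and the multiplicity |S| of s is divisible by the order
   of t^-1 s.  In the theorem this order is 3, and 3 does not divide 2|K|. *)
theory Submission
  imports Defs "HOL-Algebra.Multiplicative_Group"
begin

text \<open>With \<open>H\<close> the cyclic subgroup generated by \<open>r\<close>, the set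
  \<open>S\<close> is the union of the right cosets of \<open>H\<close> through its points. Distinct
  cosets are disjoint and each has \<open>ord r\<close> elements.\<close>

lemma (in group) ord_dvd_card_left_closed:
  assumes fin: "finite (carrier G)" and r: "r \<in> carrier G" and S: "S \<subseteq> carrier G"
    and closed: "\<And>x. x \<in> S \<Longrightarrow> r \<otimes> x \<in> S"
  shows "ord r dvd card S"
proof -
  define H where "H = generate G {r}"
  have H: "subgroup H G"
    unfolding H_def using r by (intro generate_is_subgroup) simp
  \<comment> \<open>The hypothesis on \<open>S\<close> only yields multiplication by nonnegative
    powers of \<open>r\<close>. Finiteness of the group makes these exhaust \<open>H\<close>,
    inverses included.\<close>
  have H_pow: "H = {r [^] k | k. k \<in> (UNIV :: nat set)}"
    unfolding H_def by (rule generate_pow_on_finite_carrier[OF fin r])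
  \<comment> \<open>The point \<open>x\<close> must vary in the induction: the power unfolds with
    the new factor on the right, so the hypothesis is applied to
    \<open>r \<otimes> x\<close>.\<close>
  have pow: "r [^] k \<otimes> x \<in> S" if "x \<in> S" for x and k :: nat
    using that
  proof (induction k arbitrary: x)
    case (Suc k)
    then show ?case
      using closed[OF Suc.prems] S r by (auto simp: m_assoc)
  qed (use S in auto)
  have "\<Union> ((\<lambda>x. H #> x) ` S) = S"
  proof (intro equalityI subsetI)
    fix y assume "y \<in> \<Union> ((\<lambda>x. H #> x) ` S)"
    then show "y \<in> S"
      using pow by (auto simp: H_pow r_coset_def)
  next
    fix y assume "y \<in> S"
    then show "y \<in> \<Union> ((\<lambda>x. H #> x) ` S)"
      using rcos_self[OF _ H] S by blast
  qed
  moreover have "card H dvd card (\<Union> ((\<lambda>x. H #> x) ` S))"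
  proof (rule dvd_partition)
    show "finite (\<Union> ((\<lambda>x. H #> x) ` S))"
      using calculation S fin finite_subset by metis
    have rcosets: "H #> x \<in> rcosets H" if "x \<in> S" for x
      using that S by (auto simp: RCOSETS_def)
    show "\<forall>R\<in>(\<lambda>x. H #> x) ` S. card H dvd card R"
      using card_rcosets_equal[OF rcosets subgroup.subset[OF H]] by auto
    show "\<forall>R1\<in>(\<lambda>x. H #> x) ` S. \<forall>R2\<in>(\<lambda>x. H #> x) ` S. R1 \<noteq> R2 \<longrightarrow> R1 \<inter> R2 = {}"
      using rcos_disjoint[OF H] rcosets by (auto simp: pairwise_def disjnt_def)
  qed
  ultimately show ?thesis
    using generate_pow_card[OF r] by (simp add: H_def)
qed

lemma (in group) quotient_realizable_two_values_ord_dvd_count: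
  assumes s: "s \<in> carrier G" and t: "t \<in> carrier G" and "s \<noteq> t"
    and A: "set_mset A \<subseteq> {s, t}" and "quotient_realizable G A"
  shows "ord (inv t \<otimes> s) dvd count A s"
proof -
  define I where "I = {1..order G}"
  obtain b c where b: "bij_betw b I (carrier G)" and c: "bij_betw c I (carrier G)"
    and A_eq: "A = image_mset (\<lambda>i. b i \<otimes> inv (c i)) (mset_set I)"
    using assms(5) unfolding quotient_realizable_def I_def by auto
  have finI: "finite I" by (simp add: I_def)
  have fin: "finite (carrier G)" using bij_betw_finite[OF c] finI by simp
  have bG: "b i \<in> carrier G" and cG: "c i \<in> carrier G" if "i \<in> I" for i
    using that b c by (auto dest: bij_betwE)
  have b_cases: "b i = s \<otimes> c i \<or> b i = t \<otimes> c i" if "i \<in> I" for i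
  proof -
    have "b i \<otimes> inv (c i) \<in> {s, t}"
      using A that finI by (auto simp: A_eq)
    then show ?thesis
      using bG[OF that] cG[OF that] s t by (auto simp: m_assoc)
  qed
  \<comment> \<open>\<open>J\<close> indexes the copies of \<open>s\<close> in \<open>A\<close>. Its
    image under \<open>c\<close> has the same size, because \<open>c\<close> is injective, and it is
    this image that will be closed under left multiplication by
    \<open>inv t \<otimes> s\<close>.\<close>
  define J where "J = {i \<in> I. b i = s \<otimes> c i}"
  have "b i \<otimes> inv (c i) = s \<longleftrightarrow> b i = s \<otimes> c i" if "i \<in> I" for i
    using bG[OF that] cG[OF that] s by (auto simp: m_assoc)
  then have J_eq: "J = {i \<in> I. b i \<otimes> inv (c i) = s}"
    by (auto simp: J_def)
  have "count A s = card J"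
    by (simp add: A_eq J_eq count_image_mset' finI eq_commute flip: card_eq_sum)
  also have "\<dots> = card (c ` J)"
    using c by (intro card_image[symmetric]) (auto simp: J_def bij_betw_def inj_on_def)
  finally have count: "count A s = card (c ` J)" .
  have "inv t \<otimes> s \<otimes> x \<in> c ` J" if "x \<in> c ` J" for x
  proof -
    obtain i where i: "i \<in> I" "b i = s \<otimes> c i" and x: "x = c i"
      using \<open>x \<in> c ` J\<close> by (auto simp: J_def)
    have "inv t \<otimes> s \<otimes> x \<in> carrier G"
      using s t cG[OF i(1)] x by simp
    then obtain j where j: "j \<in> I" "c j = inv t \<otimes> s \<otimes> x"
      using c by (metis bij_betw_iff_bijections)
    have "b j \<noteq> t \<otimes> c j"
    proof
      assume "b j = t \<otimes> c j"
      \<comment> \<open>Both sides equal \<open>s \<otimes> c i\<close>. Only the product of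
        \<open>t\<close> with \<open>inv t\<close> is regrouped to the left, so that it
        cancels.\<close>
      also have "\<dots> = b i"
        using s t i j x cG by (simp add: m_assoc flip: m_assoc[of t "inv t"])
      finally have "j = i"
        using b i(1) j(1) by (auto simp: bij_betw_def inj_on_def)
      then have "t \<otimes> c i = s \<otimes> c i"
        using \<open>b j = t \<otimes> c j\<close> i(2) by simp
      then show False
        using s t cG[OF i(1)] \<open>s \<noteq> t\<close> by simp
    qed
    then have "j \<in> J"
      using b_cases[OF j(1)] j(1) by (simp add: J_def)
    then show ?thesis
      using j(2) by (metis imageI)
  qed
  moreover have "c ` J \<subseteq> carrier G"
    using cG by (auto simp: J_def)
  ultimately show ?thesis
    unfolding count using s t by (intro ord_dvd_card_left_closed[OF fin]) auto
qed

lemma (in monoid) pow_even_involution: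
  assumes "x \<in> carrier G" "x \<otimes> x = \<one>"
  shows "x [^] (2 * n :: nat) = \<one>"
  using assms nat_pow_pow[of x 2 n] by (simp add: numeral_2_eq_2)

text \<open>Each factor of the product is already trivial: the projection is a homomorphism, so it
  sends an even power of an element of square one to the identity.\<close>

lemma (in group) abelianization_obstruction_even_involutions:
  assumes "\<And>a. a \<in># A \<Longrightarrow> a \<in> carrier G \<and> a \<otimes> a = \<one> \<and> even (count A a)"
  shows "abelianization_obstruction G A"
proof -
  interpret D: normal "derived G (carrier G)" G
    by (rule derived_self_is_normal)
  interpret Q: comm_group "abelianization G"
    unfolding abelianization_def by (rule derived_quot_is_comm_group)
  interpret proj: group_hom G "abelianization G" "abelianization_proj G"
    using D.r_coset_hom_Mod
    by unfold_locales (simp add: abelianization_def abelianization_proj_def[abs_def])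
  have "abelianization_proj G a [^]\<^bsub>abelianization G\<^esub> count A a = \<one>\<^bsub>abelianization G\<^esub>"
    if "a \<in># A" for a
  proof -
    obtain n where "count A a = 2 * n"
      using assms[OF \<open>a \<in># A\<close>] by blast
    moreover have "a \<in> carrier G" "a \<otimes> a = \<one>"
      using assms[OF \<open>a \<in># A\<close>] by auto
    ultimately show ?thesis
      using proj.hom_nat_pow[of a "2 * n"] pow_even_involution[of a n] by simp
  qed
  then show ?thesis
    unfolding abelianization_obstruction_def
    using assms by (auto intro!: Q.finprod_one_eqI)
qed

text \<open>Equal neighbours cancel in pairs. The start value \<open>y\<close> is arbitrary because,
  in a concatenation, the product of the later block is the start value for the earlier one.\<close>

lemma (in monoid) foldr_replicate_even_involution:
  assumes "x \<in> carrier G" "x \<otimes> x = \<one>" "y \<in> carrier G"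
  shows "foldr (\<otimes>) (replicate (2 * n) x) y = y"
proof (induction n)
  case (Suc n)
  then show ?case
    using assms by (simp flip: m_assoc)
qed simp

theorem theorem6p2:
  fixes K :: "('k, 'm) monoid_scheme"
    and G :: "((nat \<Rightarrow> nat) \<times> 'k) monoid"
    and s' t' :: "(nat \<Rightarrow> nat) \<times> 'k"
    and A :: "((nat \<Rightarrow> nat) \<times> 'k) multiset"
  assumes "group K" and "finite (carrier K)" and "\<not> 3 dvd order K"
    and "G = sym_group 3 \<times>\<times> K"
    and "s' = (Transposition.transpose 1 2, \<one>\<^bsub>K\<^esub>)"
    and "t' = (Transposition.transpose 2 3, \<one>\<^bsub>K\<^esub>)"
    and "A = replicate_mset (2 * order K) s' + replicate_mset (4 * order K) t'"
  shows "abelianization_obstruction G A \<and>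
         has_ordering_with_product_one G A \<and>
         \<not> quotient_realizable G A"
proof (intro conjI)
  interpret K: group K by fact
  interpret G: group G
    unfolding assms(4) by (rule DirProd_group[OF sym_group_is_group \<open>group K\<close>])
  have s: "s' \<in> carrier G" and t: "t' \<in> carrier G"
    by (simp_all add: assms(4-6) sym_group_carrier permutes_swap_id)
  have s2: "s' \<otimes>\<^bsub>G\<^esub> s' = \<one>\<^bsub>G\<^esub>" and t2: "t' \<otimes>\<^bsub>G\<^esub> t' = \<one>\<^bsub>G\<^esub>"
    by (simp_all add: assms(4-6) sym_group_mult sym_group_one)
  \<comment> \<open>The point 1 separates the two transpositions: the first moves it, the second
    fixes it.\<close>
  have "Transposition.transpose 1 2 (1 :: nat) \<noteq> Transposition.transpose 2 3 1"
    by (simp add: transpose_def)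
  then have neq: "s' \<noteq> t'"
    unfolding assms(5,6) by (metis prod.inject)
  have count_s: "count A s' = 2 * order K" and count_t: "count A t' = 4 * order K"
    using neq by (simp_all add: assms(7))
  have set_A: "set_mset A \<subseteq> {s', t'}"
    by (auto simp: assms(7) split: if_splits)

  show "abelianization_obstruction G A"
    using set_A s t s2 t2 count_s count_t
    by (intro G.abelianization_obstruction_even_involutions) auto

  show "has_ordering_with_product_one G A"
    unfolding has_ordering_with_product_one_def
  proof (intro exI conjI)
    \<comment> \<open>Both blocks have even length, so each cancels by itself. The length of the
      second is written as twice \<open>2 * order K\<close> to show this.\<close>
    let ?xs = "replicate (2 * order K) s' @ replicate (2 * (2 * order K)) t'"
    show "mset ?xs = A" by (simp add: assms(7))
    show "foldr (\<otimes>\<^bsub>G\<^esub>) ?xs \<one>\<^bsub>G\<^esub> = \<one>\<^bsub>G\<^esub>"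
      using s t s2 t2 by (simp only: foldr_append G.foldr_replicate_even_involution G.one_closed)
  qed

  show "\<not> quotient_realizable G A"
  proof
    define r where "r = inv\<^bsub>G\<^esub> t' \<otimes>\<^bsub>G\<^esub> s'"
    assume "quotient_realizable G A"
    then have "G.ord r dvd 2 * order K"
      unfolding r_def count_s[symmetric]
      by (rule G.quotient_realizable_two_values_ord_dvd_count[OF s t neq set_A])
    moreover have "G.ord r = 3"
    proof -
      \<comment> \<open>The involution \<open>t'\<close> is its own inverse, so \<open>r\<close> is
        a product of two transpositions in the first component and trivial in the second.\<close>
      have r_eq: "r = t' \<otimes>\<^bsub>G\<^esub> s'"
        unfolding r_def using G.inv_equality[OF t2 t t] by simp
      have r: "r \<in> carrier G"
        using s t by (simp add: r_eq)
      have "r \<noteq> \<one>\<^bsub>G\<^esub>"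
        using neq s t G.inv_solve_left[of "\<one>\<^bsub>G\<^esub>" t' s'] by (auto simp: r_def)
      then have "G.ord r \<noteq> 1"
        using r by (simp only: G.ord_eq_1 not_False_eq_True)
      \<comment> \<open>The composite of the two transpositions is the 3-cycle sending 1 to 3, 3 to
        2 and 2 to 1. The bracketing is that of the unfolded third power of
        \<open>r\<close>.\<close>
      have "Transposition.transpose 2 3 \<circ> Transposition.transpose 1 2
          \<circ> (Transposition.transpose 2 3 \<circ> Transposition.transpose 1 2)
          \<circ> (Transposition.transpose 2 3 \<circ> Transposition.transpose 1 2) = (id :: nat \<Rightarrow> nat)"
        by (auto simp: fun_eq_iff transpose_def)
      then have "r [^]\<^bsub>G\<^esub> (3 :: nat) = \<one>\<^bsub>G\<^esub>"
        by (simp add: r_eq numeral_3_eq_3 assms(4-6) sym_group_mult sym_group_one)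
      then have dvd: "G.ord r dvd 3"
        using r by (simp only: G.pow_eq_id)
      then have "G.ord r \<le> 3"
        by (rule dvd_imp_le) simp
      with dvd \<open>G.ord r \<noteq> 1\<close> show ?thesis
        \<comment> \<open>The bound leaves 0, 1, 2 and 3. The value 1 is excluded since
          \<open>r\<close> is nontrivial, and neither 0 nor 2 divides 3.\<close>
        by (cases "G.ord r = 0 \<or> G.ord r = 2") auto
    qed
    ultimately have "3 dvd 2 * order K" by simp
    then have "3 dvd order K" by presburger
    with assms(3) show False by contradiction
  qed
qed

end
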